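(* For any connected graph $G$ of order $n\ge 2$, $$2n+\gamma_t(M(G))\le \gamma_{tc}(M(G\circ P_2))\le 4n.$$
   Context: All graphs are finite, simple and undirected. The $2$-corona $G\circ P_2$ is the graph of order $3|V(G)|$ obtained from $G$ by attaching to each vertex $v$ of $G$ a path of length $2$ (i.e., new vertices $a_v,b_v$ and edges $va_v$, $a_vb_v$), these paths being vertex-disjoint. For a graph $H$, a set $D\subseteq V(H)$ is a total dominating set if every vertex of $H$ has a neighbor in $D$; $\gamma_t(H)$ is the minimum cardinality of a total dominating set of $H$. A set $D\subseteq V(H)$ is a total outer-connected dominating set of $H$ if $D$ is a total dominating set and the induced subgraph $H[V(H)\setminus D]$ is connected; $\gamma_{tc}(H)$ denotes the minimum cardinality of a total outer-connected dominating set of $H$. The middle graph $M(G)$ of a graph $G$ has vertex set $V(G)\cup E(G)$, where two elements $x,y$ are adjacent iff either $x,y\in E(G)$ are edges of $G$ sharing an endpoint, or one of them is a vertex of $G$ and the other is an edge of $G$ incident to it. *)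

theory Defs
  imports "Graph_Theory.Graph_Theory"
begin

text \<open>A finite simple undirected graph is a record satisfying the locale predicate
  \<^const>\<open>pair_graph\<close>: an undirected edge \<open>uv\<close> is the pair of opposite arcs \<open>(u,v)\<close>, \<open>(v,u)\<close>.
  Its undirected edges are recovered as two-element vertex sets.\<close>

definition edges :: "'a pair_pre_digraph \<Rightarrow> 'a set set" where
  "edges G = {{u, v} | u v. (u, v) \<in> parcs G}"

datatype 'a corona_vertex = Orig 'a | Near 'a | Far 'a

text \<open>\<open>Near v\<close> and \<open>Far v\<close> are the vertices \<open>a\<^sub>v\<close> and \<open>b\<^sub>v\<close> of the path attached to \<open>v\<close>.\<close>

definition corona_P2 :: "'a pair_pre_digraph \<Rightarrow> 'a corona_vertex pair_pre_digraph" where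
  "corona_P2 G = \<lparr>
     pverts = Orig ` pverts G \<union> Near ` pverts G \<union> Far ` pverts G,
     parcs = {(Orig u, Orig v) | u v. (u, v) \<in> parcs G}
       \<union> (\<Union>v\<in>pverts G. {(Orig v, Near v), (Near v, Orig v), (Near v, Far v), (Far v, Near v)}) \<rparr>"

definition middle_graph :: "'a pair_pre_digraph \<Rightarrow> ('a + 'a set) pair_pre_digraph" where
  "middle_graph G = \<lparr>
     pverts = Inl ` pverts G \<union> Inr ` edges G,
     parcs = {(Inr e, Inr f) | e f. e \<in> edges G \<and> f \<in> edges G \<and> e \<noteq> f \<and> e \<inter> f \<noteq> {}}
       \<union> {(Inl v, Inr e) | v e. v \<in> pverts G \<and> e \<in> edges G \<and> v \<in> e}
       \<union> {(Inr e, Inl v) | v e. v \<in> pverts G \<and> e \<in> edges G \<and> v \<in> e} \<rparr>"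

definition total_dominating_set :: "'a pair_pre_digraph \<Rightarrow> 'a set \<Rightarrow> bool" where
  "total_dominating_set H D \<longleftrightarrow>
     D \<subseteq> pverts H \<and> (\<forall>v\<in>pverts H. \<exists>u\<in>D. (v, u) \<in> parcs H)"

definition total_domination_number :: "'a pair_pre_digraph \<Rightarrow> nat" where
  "total_domination_number H = (LEAST k. \<exists>D. total_dominating_set H D \<and> card D = k)"

text \<open>\<^const>\<open>Digraph_Component.connected\<close> requires a nonempty vertex set, so the whole vertex set
  is never total outer-connected dominating.\<close>

definition total_outer_connected_dominating_set :: "'a pair_pre_digraph \<Rightarrow> 'a set \<Rightarrow> bool" where
  "total_outer_connected_dominating_set H D \<longleftrightarrow>
     total_dominating_set H D \<and>
     Digraph_Component.connected (with_proj H \<restriction> (pverts H - D))"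

definition total_outer_connected_domination_number :: "'a pair_pre_digraph \<Rightarrow> nat" where
  "total_outer_connected_domination_number H =
     (LEAST k. \<exists>D. total_outer_connected_dominating_set H D \<and> card D = k)"

lemma finite_edges:
  assumes "pair_graph G"
  shows "finite (edges G)"
proof -
  interpret pair_graph G by fact
  have "edges G = (\<lambda>(u, v). {u, v}) ` parcs G"
    by (auto simp: edges_def)
  then show ?thesis
    using pair_finite_arcs by simp
qed

lemma pair_graph_corona_P2:
  assumes "pair_graph G"
  shows "pair_graph (corona_P2 G)"
proof -
  interpret pair_graph G by fact
  have arcs: "{(Orig u, Orig v) | u v. (u, v) \<in> parcs G} = map_prod Orig Orig ` parcs G"
    by force
  show ?thesis
  proof
    show "finite (parcs (corona_P2 G))"
      unfolding corona_P2_def arcs by simp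
    show "symmetric (with_proj (corona_P2 G))"
      unfolding symmetric_def
      by (rule symI) (auto simp: corona_P2_def dest: arcs_symmetric)
  qed (auto simp: corona_P2_def dest: in_arcsD1 in_arcsD2 no_loops')
qed

lemma card_corona_P2:
  assumes "pair_graph G"
  shows "card (pverts (corona_P2 G)) = 3 * card (pverts G)"
proof -
  interpret pair_graph G by fact
  have "card (pverts (corona_P2 G))
      = card (Orig ` pverts G) + card (Near ` pverts G) + card (Far ` pverts G)"
    unfolding corona_P2_def pair_pre_digraph.simps
    by (subst card_Un_disjoint; auto)+
  then show ?thesis
    by (simp add: card_image inj_on_def)
qed

lemma pair_graph_middle_graph:
  assumes "pair_graph G"
  shows "pair_graph (middle_graph G)"
proof -
  interpret pair_graph G by fact
  have fin: "finite (pverts (middle_graph G))"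
    using finite_edges[OF assms] by (simp add: middle_graph_def)
  show ?thesis
  proof
    have "parcs (middle_graph G) \<subseteq> pverts (middle_graph G) \<times> pverts (middle_graph G)"
      by (auto simp: middle_graph_def)
    then show "finite (parcs (middle_graph G))"
      using fin finite_subset by blast
    show "symmetric (with_proj (middle_graph G))"
      unfolding symmetric_def by (rule symI) (auto simp: middle_graph_def)
  qed (use fin in \<open>auto simp: middle_graph_def\<close>)
qed

end

theory Submission
  imports Defs
begin

text \<open>
  Let \<open>D\<close> be total outer-connected dominating in \<open>M(G \<circ> P\<^sub>2)\<close>. The vertex \<open>b\<^sub>v\<close> has \<open>a\<^sub>vb\<^sub>v\<close> as its only
  neighbour, so all edges \<open>a\<^sub>vb\<^sub>v\<close> lie in \<open>D\<close>, and a vertex \<open>b\<^sub>v\<close> outside \<open>D\<close> is isolated in the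
  complement of \<open>D\<close> and hence is the whole complement. So \<open>D\<close> contains either all \<open>b\<^sub>v\<close> or all
  \<open>a\<^sub>v\<close>, which accounts for \<open>2n\<close> elements. The remaining ones yield a total dominating set of
  \<open>M(G)\<close> of at most the same size, once each edge \<open>va\<^sub>v\<close> in \<open>D\<close> is replaced as follows: by \<open>v\<close>
  if an edge of \<open>G\<close> in \<open>D\<close> covers \<open>v\<close>; otherwise by an edge \<open>f v\<close> of \<open>G\<close> at \<open>v\<close>, except that if
  both ends of an edge choose that edge, one of them is replaced by itself.

  For the upper bound, the set of all \<open>a\<^sub>v\<close>, \<open>b\<^sub>v\<close>, \<open>va\<^sub>v\<close>, \<open>a\<^sub>vb\<^sub>v\<close> is total dominating, and its
  complement induces a copy of the connected graph \<open>M(G)\<close>.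
\<close>

section \<open>Adjacency in middle graphs and the edges of the corona\<close>

abbreviation spoke :: "'a \<Rightarrow> 'a corona_vertex set" where
  "spoke v \<equiv> {Orig v, Near v}"

abbreviation leaf :: "'a \<Rightarrow> 'a corona_vertex set" where
  "leaf v \<equiv> {Near v, Far v}"

lemma pverts_middle_graph:
  "pverts (middle_graph G) = Inl ` pverts G \<union> Inr ` edges G"
  by (simp add: middle_graph_def)

lemma in_pverts_middle_graph:
  "Inl v \<in> pverts (middle_graph G) \<longleftrightarrow> v \<in> pverts G"
  "Inr e \<in> pverts (middle_graph G) \<longleftrightarrow> e \<in> edges G"
  by (auto simp: pverts_middle_graph)

lemma parcs_middle_graph:
  "(Inr e, Inr f) \<in> parcs (middle_graph G) \<longleftrightarrow> e \<in> edges G \<and> f \<in> edges G \<and> e \<noteq> f \<and> e \<inter> f \<noteq> {}"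
  "(Inl v, Inr e) \<in> parcs (middle_graph G) \<longleftrightarrow> v \<in> pverts G \<and> e \<in> edges G \<and> v \<in> e"
  "(Inr e, Inl v) \<in> parcs (middle_graph G) \<longleftrightarrow> v \<in> pverts G \<and> e \<in> edges G \<and> v \<in> e"
  "(Inl u, Inl v) \<notin> parcs (middle_graph G)"
  by (auto simp: middle_graph_def)

lemma pverts_corona_P2:
  "pverts (corona_P2 G) = Orig ` pverts G \<union> Near ` pverts G \<union> Far ` pverts G"
  by (simp add: corona_P2_def)

lemma edges_corona_P2:
  "edges (corona_P2 G) = (`) Orig ` edges G \<union> spoke ` pverts G \<union> leaf ` pverts G"
proof (intro equalityI subsetI)
  fix e assume "e \<in> edges (corona_P2 G)"
  then obtain x y where e: "e = {x, y}" and xy: "(x, y) \<in> parcs (corona_P2 G)"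
    by (auto simp: edges_def)
  consider (orig) u v where "(u, v) \<in> parcs G" "x = Orig u" "y = Orig v"
    | (spoke) v where "v \<in> pverts G" "x = Orig v \<and> y = Near v \<or> x = Near v \<and> y = Orig v"
    | (leaf) v where "v \<in> pverts G" "x = Near v \<and> y = Far v \<or> x = Far v \<and> y = Near v"
    using xy by (auto simp: corona_P2_def)
  then show "e \<in> (`) Orig ` edges G \<union> spoke ` pverts G \<union> leaf ` pverts G"
  proof cases
    case orig
    then have "{u, v} \<in> edges G" "e = Orig ` {u, v}"
      using e by (auto simp: edges_def)
    then show ?thesis by blast
  next
    case spoke
    then show ?thesis using e by blast
  next
    case leaf
    then show ?thesis using e by blast
  qed
next
  fix e assume "e \<in> (`) Orig ` edges G \<union> spoke ` pverts G \<union> leaf ` pverts G"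
  moreover have "Orig ` f \<in> edges (corona_P2 G)" if f: "f \<in> edges G" for f
  proof -
    obtain u v where "f = {u, v}" "(u, v) \<in> parcs G"
      using f by (auto simp: edges_def)
    then have "Orig ` f = {Orig u, Orig v}" "(Orig u, Orig v) \<in> parcs (corona_P2 G)"
      by (auto simp: corona_P2_def)
    then show ?thesis
      unfolding edges_def by blast
  qed
  moreover have "spoke v \<in> edges (corona_P2 G)" "leaf v \<in> edges (corona_P2 G)"
    if "v \<in> pverts G" for v
  proof -
    have "(Orig v, Near v) \<in> parcs (corona_P2 G)" "(Near v, Far v) \<in> parcs (corona_P2 G)"
      using that by (auto simp: corona_P2_def)
    then show "spoke v \<in> edges (corona_P2 G)" "leaf v \<in> edges (corona_P2 G)"
      unfolding edges_def by blast+
  qed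
  ultimately show "e \<in> edges (corona_P2 G)"
    by blast
qed

lemma (in pair_graph) edgesE:
  assumes "e \<in> edges G"
  obtains u v where "e = {u, v}" "u \<noteq> v" "u \<in> pverts G" "v \<in> pverts G"
  using assms by (auto simp: edges_def dest: in_arcsD1 in_arcsD2 no_loops')

section \<open>Consequences of connectedness\<close>

text \<open>The first step of a walk from \<open>u\<close> to \<open>v\<close> gives
  \<open>w\<close>. This serves both for \<open>G\<close> and for the complement of a dominating
  set.\<close>

lemma connected_has_neighbour:
  assumes "Digraph_Component.connected K" "u \<in> verts K" "v \<in> verts K" "u \<noteq> v"
  obtains w where "w \<in> verts K" "(u, w) \<in> (arcs_ends K)\<^sup>s"
proof -
  have "(u, v) \<in> rtrancl_on (verts K) ((arcs_ends K)\<^sup>s)"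
    using assms by (simp add: connected_conv)
  then show thesis
    using assms(4) that by (cases rule: converse_rtrancl_on_cases) (auto dest: in_rtrancl_on_in_F)
qed

lemma connected_no_isolated:
  assumes "pair_graph G" "Digraph_Component.connected (with_proj G)" "card (pverts G) \<ge> 2"
    and "v \<in> pverts G"
  shows "\<exists>e\<in>edges G. v \<in> e"
proof -
  interpret pair_graph G by fact
  have "\<not> pverts G \<subseteq> {v}"
    using assms(3) card_mono[of "{v}" "pverts G"] by auto
  then obtain w where "w \<in> pverts G" "w \<noteq> v"
    by blast
  then obtain x where "(v, x) \<in> (parcs G)\<^sup>s"
    using connected_has_neighbour[OF assms(2), of v w] assms(4) by auto
  then show ?thesis
    by (auto simp: symcl_def edges_def)
qed

section \<open>From traces on the corona to a total dominating set of M(G)\<close>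

text \<open>\<open>A\<close>, \<open>W\<close> and \<open>S\<close> stand for the edges of
  \<open>G\<close>, the vertices of \<open>G\<close> and the spokes found in a dominating set of the
  corona's middle graph. A spoke at \<open>v\<close> dominates \<open>v\<close> and all edges of
  \<open>G\<close> at \<open>v\<close>. In M(G) the vertex \<open>v\<close> does only the second
  job, and an edge at \<open>v\<close> does both except that it does not dominate itself.\<close>

lemma total_dominating_set_of_covers:
  assumes "pair_graph G"
    and AE: "A \<subseteq> edges G" and WV: "W \<subseteq> pverts G" and SV: "S \<subseteq> pverts G"
    and noniso: "\<And>v. v \<in> pverts G \<Longrightarrow> \<exists>e\<in>edges G. v \<in> e"
    and vcov: "\<And>v. v \<in> pverts G \<Longrightarrow> v \<in> S \<or> (\<exists>e\<in>A. v \<in> e)"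
    and ecov: "\<And>e. e \<in> edges G \<Longrightarrow> (\<exists>v\<in>e. v \<in> W \<union> S) \<or> (\<exists>f\<in>A. f \<noteq> e \<and> f \<inter> e \<noteq> {})"
  shows "\<exists>T. total_dominating_set (middle_graph G) T \<and> card T \<le> card A + card W + card S"
proof -
  interpret pair_graph G by fact
  \<comment> \<open>For \<open>v\<close> in \<open>S - U\<close> an edge in \<open>A\<close> already
    dominates \<open>v\<close>, so the vertex \<open>v\<close> is an adequate substitute for its
    spoke. Only \<open>U\<close> needs new edges.\<close>
  define U where "U = {v \<in> S. \<forall>e\<in>A. v \<notin> e}"
  obtain f where f: "\<And>v. v \<in> pverts G \<Longrightarrow> f v \<in> edges G \<and> v \<in> f v"
    using noniso by metis
  \<comment> \<open>When both ends of an edge choose it, only the end picked by \<open>rep\<close>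
    contributes the edge. The other end contributes itself and thereby dominates that edge, at no
    extra cost.\<close>
  define rep where "rep e = (SOME v. v \<in> U \<and> f v = e)" for e
  have rep: "rep (f v) \<in> U \<and> f (rep (f v)) = f v" if "v \<in> U" for v
    unfolding rep_def by (rule someI[of _ v]) (use that in simp)
  define h :: "'a \<Rightarrow> 'a + 'a set" where
    "h v = (if rep (f v) = v then Inr (f v) else Inl v)" for v
  define T where "T = Inr ` A \<union> Inl ` W \<union> (Inl ` (S - U) \<union> h ` U)"
  have US: "U \<subseteq> S" and UV: "U \<subseteq> pverts G"
    using SV by (auto simp: U_def)
  have fin: "finite A" "finite W" "finite S" "finite U"
    using AE WV SV UV finite_edges[OF assms(1)] pair_finite_verts by (meson finite_subset)+
  \<comment> \<open>Even if \<open>v\<close> contributes only a vertex, its chosen edge enters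
    \<open>T\<close> through the representative.\<close>
  have fT: "Inr (f v) \<in> T" if "v \<in> U" for v
  proof -
    have "h (rep (f v)) = Inr (f v)"
      using rep[OF that] by (simp add: h_def)
    then show ?thesis
      using rep[OF that] by (metis T_def UnI2 imageI)
  qed
  have vT: "Inl v \<in> T \<or> v \<in> U \<and> rep (f v) = v" if "v \<in> S" for v
    using that by (auto simp: T_def h_def image_iff)
  have "card T \<le> card (Inr ` A :: ('a + 'a set) set) + card (Inl ` W :: ('a + 'a set) set)
      + (card (Inl ` (S - U) :: ('a + 'a set) set) + card (h ` U))"
    unfolding T_def by (intro card_Un_le[THEN order_trans] add_mono card_Un_le)
  also have "\<dots> \<le> card A + card W + (card (S - U) + card U)"
    by (intro add_mono card_image_le) (use fin in auto)
  also have "card (S - U) + card U = card S"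
    using US fin by (metis card_Diff_subset card_mono le_add_diff_inverse2)
  finally have card: "card T \<le> card A + card W + card S" .
  have "h v \<in> pverts (middle_graph G)" if "v \<in> U" for v
    using that UV f by (auto simp: h_def in_pverts_middle_graph)
  then have "T \<subseteq> pverts (middle_graph G)"
    using AE WV SV by (auto simp: T_def in_pverts_middle_graph)
  moreover have "\<exists>y\<in>T. (x, y) \<in> parcs (middle_graph G)" if "x \<in> pverts (middle_graph G)" for x
  proof (cases x)
    case (Inl v)
    then have v: "v \<in> pverts G"
      using that by (auto simp: pverts_middle_graph)
    have "\<exists>e. Inr e \<in> T \<and> e \<in> edges G \<and> v \<in> e"
    proof (cases "v \<in> U")
      case True
      then show ?thesis using fT f[OF v] by blast
    next
      case False
      then obtain e where "e \<in> A" "v \<in> e"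
        using vcov[OF v] by (auto simp: U_def)
      then show ?thesis using AE by (auto simp: T_def)
    qed
    then show ?thesis
      using v Inl by (metis parcs_middle_graph(2))
  next
    case (Inr e)
    then have e: "e \<in> edges G"
      using that by (auto simp: pverts_middle_graph)
    have "(\<exists>v\<in>e. Inl v \<in> T) \<or> (\<exists>g\<in>edges G. g \<noteq> e \<and> g \<inter> e \<noteq> {} \<and> Inr g \<in> T)"
      (is "?V \<or> ?E")
    proof (rule ccontr)
      \<comment> \<open>If nothing in \<open>T\<close> dominates \<open>e\<close>, then
        \<open>ecov\<close> yields an end \<open>x\<close> in \<open>S\<close> that is missing from
        \<open>T\<close>. So \<open>x\<close> lies in \<open>U\<close>, represents its choice, and
        chose \<open>e\<close>. As \<open>e\<close> is not in \<open>A\<close>, no edge of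
        \<open>A\<close> covers the other end \<open>y\<close>, so the same holds for
        \<open>y\<close>, and \<open>e\<close> would have two representatives.\<close>
      assume neg: "\<not> (?V \<or> ?E)"
      have V: "Inl v \<notin> T" if "v \<in> e" for v
        using neg that by blast
      have E: "g = e" if "g \<in> edges G" "Inr g \<in> T" "y \<in> g" "y \<in> e" for g y
        using neg that by blast
      have A: "g = e" if "g \<in> A" "y \<in> g" "y \<in> e" for g y
        by (rule E[of g y]) (use that AE in \<open>auto simp: T_def\<close>)
      have "v \<notin> W" if "v \<in> e" for v
        using V[OF that] by (auto simp: T_def)
      moreover have "\<not> (\<exists>g\<in>A. g \<noteq> e \<and> g \<inter> e \<noteq> {})"
        using A by (meson disjoint_iff)
      ultimately obtain x where x: "x \<in> e" "x \<in> S"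
        using ecov[OF e] by (meson UnE)
      then have xU: "x \<in> U" "rep (f x) = x"
        using vT V by auto
      have fe: "f y = e" if "y \<in> U" "y \<in> e" for y
        using E[of "f y" y] fT[OF that(1)] f[of y] that UV by auto
      obtain y where y: "y \<in> e" "y \<noteq> x" "y \<in> pverts G"
        using e x(1) by (elim edgesE) auto
      have "e \<notin> A"
        using xU x by (auto simp: U_def)
      then have "y \<in> S"
        using vcov[OF y(3)] A y by blast
      then have "y \<in> U" "rep (f y) = y"
        using vT V y by auto
      then show False
        using fe y xU x by metis
    qed
    then show ?thesis
    proof
      assume ?V
      moreover have "e \<subseteq> pverts G"
        using e by (elim edgesE) auto
      ultimately show ?thesis
        using e Inr by (metis parcs_middle_graph(3) subsetD)
    next
      assume ?E
      then show ?thesis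
        using e Inr by (metis parcs_middle_graph(1) inf_commute)
    qed
  qed
  ultimately show ?thesis
    using card by (auto simp: total_dominating_set_def)
qed

section \<open>Lower bound\<close>

lemma total_outer_connected_middle_corona_lower:
  assumes "pair_graph G" "Digraph_Component.connected (with_proj G)" "card (pverts G) \<ge> 2"
    and D: "total_outer_connected_dominating_set (middle_graph (corona_P2 G)) D"
  shows "2 * card (pverts G) + total_domination_number (middle_graph G) \<le> card D"
proof -
  interpret pair_graph G by fact
  let ?V = "pverts G" and ?M = "middle_graph (corona_P2 G)"
  interpret M: pair_graph ?M
    by (intro pair_graph_middle_graph pair_graph_corona_P2 assms(1))
  have DM: "D \<subseteq> pverts ?M"
    and dom: "\<And>x. x \<in> pverts ?M \<Longrightarrow> \<exists>y\<in>D. (x, y) \<in> parcs ?M"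
    and conn: "Digraph_Component.connected (with_proj ?M \<restriction> (pverts ?M - D))"
    using D by (auto simp: total_outer_connected_dominating_set_def total_dominating_set_def)
  have finD: "finite D"
    using DM M.pair_finite_verts finite_subset by blast
  have far_nb: "y = Inr (leaf v)" if "(Inl (Far v), y) \<in> parcs ?M" for v y
    using that by (cases y) (auto simp: parcs_middle_graph edges_corona_P2)
  have leafD: "Inr (leaf v) \<in> D" if "v \<in> ?V" for v
    using dom[of "Inl (Far v)"] far_nb that
    by (force simp: pverts_middle_graph pverts_corona_P2)
  have only_far: "pverts ?M - D = {Inl (Far v)}" if v: "v \<in> ?V" "Inl (Far v) \<notin> D" for v
  proof (rule ccontr)
    let ?K = "with_proj ?M \<restriction> (pverts ?M - D)"
    assume "pverts ?M - D \<noteq> {Inl (Far v)}"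
    moreover have u: "Inl (Far v) \<in> pverts ?M - D"
      using v by (auto simp: pverts_middle_graph pverts_corona_P2)
    ultimately obtain x where "x \<in> pverts ?M - D" "x \<noteq> Inl (Far v)"
      by blast
    then obtain w where "w \<in> verts ?K" "(Inl (Far v), w) \<in> (arcs_ends ?K)\<^sup>s"
      using connected_has_neighbour[OF conn, of "Inl (Far v)" x] u by auto
    then have "w \<notin> D" "(Inl (Far v), w) \<in> parcs ?M"
      by (auto simp: symcl_def arcs_ends_conv intro: M.arcs_symmetric)
    then show False
      using far_nb leafD[OF v(1)] by blast
  qed
  \<comment> \<open>\<open>P\<close> names a layer of path vertices contained in \<open>D\<close>,
    so that both cases are counted alike. If some \<open>Far v\<close> is missing, it is the whole
    complement, and every \<open>Near w\<close> is in \<open>D\<close>.\<close>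
  obtain P where P: "P = Far \<or> P = Near" and PD: "\<And>v. v \<in> ?V \<Longrightarrow> Inl (P v) \<in> D"
  proof (cases "\<forall>v\<in>?V. Inl (Far v) \<in> D")
    case True
    then show thesis using that[of Far] by blast
  next
    case False
    then obtain v where "pverts ?M - D = {Inl (Far v)}"
      using only_far by blast
    moreover have "Inl (Near w) \<in> pverts ?M" if "w \<in> ?V" for w
      using that by (simp add: in_pverts_middle_graph pverts_corona_P2)
    ultimately have "Inl (Near w) \<in> D" if "w \<in> ?V" for w
      using that by blast
    then show thesis using that[of Near] by blast
  qed

  define A where "A = {e \<in> edges G. Inr (Orig ` e) \<in> D}"
  define W where "W = {v \<in> ?V. Inl (Orig v) \<in> D}"
  define S where "S = {v \<in> ?V. Inr (spoke v) \<in> D}"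
  have inj_Orig: "Orig ` e = Orig ` f \<longleftrightarrow> e = f" for e f :: "'a set"
    by (simp add: inj_image_eq_iff inj_def)
  have vcov: "v \<in> S \<or> (\<exists>e\<in>A. v \<in> e)" if v: "v \<in> ?V" for v
  proof -
    obtain y where "y \<in> D" "(Inl (Orig v), y) \<in> parcs ?M"
      using dom[of "Inl (Orig v)"] v by (auto simp: in_pverts_middle_graph pverts_corona_P2)
    then show ?thesis
      by (cases y) (auto simp: A_def S_def parcs_middle_graph edges_corona_P2)
  qed
  \<comment> \<open>No leaf edge meets a copy of an edge of \<open>G\<close>, so the leaf edges in
    \<open>D\<close> are of no help here.\<close>
  have ecov: "(\<exists>v\<in>e. v \<in> W \<union> S) \<or> (\<exists>f\<in>A. f \<noteq> e \<and> f \<inter> e \<noteq> {})" if e: "e \<in> edges G" for e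
  proof -
    obtain y where "y \<in> D" "(Inr (Orig ` e), y) \<in> parcs ?M"
      using dom[of "Inr (Orig ` e)"] e by (auto simp: in_pverts_middle_graph edges_corona_P2)
    then show ?thesis
      by (cases y)
        (auto simp: A_def W_def S_def parcs_middle_graph edges_corona_P2 pverts_corona_P2)
  qed
  obtain T where T: "total_dominating_set (middle_graph G) T" "card T \<le> card A + card W + card S"
    using total_dominating_set_of_covers[OF assms(1), of A W S]
      connected_no_isolated[OF assms(1,2,3)] vcov ecov
    by (auto simp: A_def W_def S_def)

  let ?A = "(\<lambda>e. Inr (Orig ` e)) ` A :: ('a corona_vertex + 'a corona_vertex set) set" and ?W = "(\<lambda>v. Inl (Orig v)) ` W :: ('a corona_vertex + 'a corona_vertex set) set"
    and ?S = "(\<lambda>v. Inr (spoke v)) ` S :: ('a corona_vertex + 'a corona_vertex set) set" and ?L = "(\<lambda>v. Inr (leaf v)) ` ?V :: ('a corona_vertex + 'a corona_vertex set) set"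
    and ?P = "(\<lambda>v. Inl (P v)) ` ?V :: ('a corona_vertex + 'a corona_vertex set) set"
  have fin: "finite A" "finite W" "finite S" "finite ?V"
    using finite_edges[OF assms(1)] pair_finite_verts by (auto simp: A_def W_def S_def)
  have ne: "Orig ` e \<noteq> spoke v" "Orig ` e \<noteq> leaf v" "spoke u \<noteq> leaf v" for e and u v :: 'a
    by auto
  \<comment> \<open>Five disjoint pieces of \<open>D\<close>: the three traces, the leaf edges and
    the layer \<open>P\<close>. The last two supply the summand 2n.\<close>
  have "card A + card W + card S + card ?V + card ?V
      = card ?A + card ?W + card ?S + card ?L + card ?P"
    using P by (subst (1 2 3 4 5) card_image) (auto simp: inj_on_def inj_Orig doubleton_eq_iff)
  also have "\<dots> = card (?A \<union> ?W \<union> ?S \<union> ?L \<union> ?P)"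
  proof -
    have "?A \<inter> ?W = {}" "(?A \<union> ?W) \<inter> ?S = {}" "(?A \<union> ?W \<union> ?S) \<inter> ?L = {}"
      "(?A \<union> ?W \<union> ?S \<union> ?L) \<inter> ?P = {}"
      using P ne by auto
    then show ?thesis
      using fin by (simp only: card_Un_disjoint finite_UnI finite_imageI)
  qed
  also have "\<dots> \<le> card D"
    using leafD PD finD by (intro card_mono) (auto simp: A_def W_def S_def)
  finally have "2 * card ?V + card T \<le> card D"
    using T(2) by simp
  moreover have "total_domination_number (middle_graph G) \<le> card T"
    unfolding total_domination_number_def using T(1) by (intro Least_le) blast
  ultimately show ?thesis by simp
qed

section \<open>Upper bound\<close>

lemma total_outer_connected_middle_corona_upper:
  assumes "pair_graph G" "Digraph_Component.connected (with_proj G)"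
  shows "\<exists>D. total_outer_connected_dominating_set (middle_graph (corona_P2 G)) D
    \<and> card D = 4 * card (pverts G)"
proof -
  interpret pair_graph G by fact
  let ?V = "pverts G" and ?M = "middle_graph (corona_P2 G)"
  let ?N = "(\<lambda>v. Inl (Near v)) ` ?V :: ('a corona_vertex + 'a corona_vertex set) set" and ?F = "(\<lambda>v. Inl (Far v)) ` ?V :: ('a corona_vertex + 'a corona_vertex set) set"
    and ?S = "(\<lambda>v. Inr (spoke v)) ` ?V :: ('a corona_vertex + 'a corona_vertex set) set" and ?L = "(\<lambda>v. Inr (leaf v)) ` ?V :: ('a corona_vertex + 'a corona_vertex set) set"
  define D where "D = ?N \<union> ?F \<union> ?S \<union> ?L"
  have "card D = card ?N + card ?F + card ?S + card ?L"
  proof -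
    have "?N \<inter> ?F = {}" "(?N \<union> ?F) \<inter> ?S = {}" "(?N \<union> ?F \<union> ?S) \<inter> ?L = {}"
      by auto
    then show ?thesis
      unfolding D_def using pair_finite_verts
      by (simp only: card_Un_disjoint finite_UnI finite_imageI)
  qed
  also have "\<dots> = 4 * card ?V"
    by (subst (1 2 3 4) card_image) (auto simp: inj_on_def doubleton_eq_iff)
  finally have card: "card D = 4 * card ?V" .

  have "D \<subseteq> pverts ?M"
    by (auto simp: D_def pverts_middle_graph pverts_corona_P2 edges_corona_P2)
  moreover have "\<exists>y\<in>D. (x, y) \<in> parcs ?M" if x: "x \<in> pverts ?M" for x
  proof -
    consider (orig) v where "v \<in> ?V" "x = Inl (Orig v)"
      | (path) v where "v \<in> ?V" "x = Inl (Near v) \<or> x = Inl (Far v) \<or> x = Inr (spoke v)"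
      | (leaf) v where "v \<in> ?V" "x = Inr (leaf v)"
      | (edge) e where "e \<in> edges G" "x = Inr (Orig ` e)"
      using x by (auto simp: pverts_middle_graph pverts_corona_P2 edges_corona_P2)
    then show ?thesis
    proof cases
      case orig
      then have "Inr (spoke v) \<in> D" "(x, Inr (spoke v)) \<in> parcs ?M"
        by (auto simp: D_def parcs_middle_graph pverts_corona_P2 edges_corona_P2)
      then show ?thesis by blast
    next
      case path
      then have "Inr (leaf v) \<in> D" "(x, Inr (leaf v)) \<in> parcs ?M"
        by (auto simp: D_def parcs_middle_graph pverts_corona_P2 edges_corona_P2 doubleton_eq_iff)
      then show ?thesis by blast
    next
      case leaf
      then have "Inl (Far v) \<in> D" "(x, Inl (Far v)) \<in> parcs ?M"
        by (auto simp: D_def parcs_middle_graph pverts_corona_P2 edges_corona_P2)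
      then show ?thesis by blast
    next
      case edge
      then obtain v where "v \<in> e" "v \<in> ?V"
        by (elim edgesE) auto
      with edge have "Inr (spoke v) \<in> D" "(x, Inr (spoke v)) \<in> parcs ?M"
        by (auto simp: D_def parcs_middle_graph edges_corona_P2)
      then show ?thesis by blast
    qed
  qed
  ultimately have tds: "total_dominating_set ?M D"
    by (simp add: total_dominating_set_def)

  let ?K = "with_proj ?M \<restriction> (pverts ?M - D)"
  let ?R = "rtrancl_on (verts ?K) ((arcs_ends ?K)\<^sup>s)"
  have verts: "verts ?K = (\<lambda>v. Inl (Orig v)) ` ?V \<union> (\<lambda>e. Inr (Orig ` e)) ` edges G"
    by (auto simp: D_def pverts_middle_graph pverts_corona_P2 edges_corona_P2)
  have symR: "sym ?R"
    by (intro rtrancl_on_sym symI) (auto simp: symcl_def)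
  have incidence: "(Inl (Orig v), Inr (Orig ` e)) \<in> ?R" if "v \<in> ?V" "e \<in> edges G" "v \<in> e" for v e
  proof -
    have "Inl (Orig v) \<in> verts ?K" "Inr (Orig ` e) \<in> verts ?K"
      unfolding verts using that by auto
    moreover have "(Inl (Orig v), Inr (Orig ` e)) \<in> parcs ?M"
      using that by (auto simp: parcs_middle_graph pverts_corona_P2 edges_corona_P2)
    ultimately have "(Inl (Orig v), Inr (Orig ` e)) \<in> (arcs_ends ?K)\<^sup>s"
      by (force simp: symcl_def arcs_ends_conv)
    then show ?thesis
      using \<open>Inl (Orig v) \<in> verts ?K\<close> \<open>Inr (Orig ` e) \<in> verts ?K\<close>
      by (meson rtrancl_on_refl rtrancl_on_into_rtrancl_on)
  qed
  \<comment> \<open>A step from \<open>y\<close> to \<open>z\<close> in \<open>G\<close> lifts to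
    two steps through the edge \<open>{y, z}\<close>. The second is an incidence traversed
    backwards, hence the appeal to \<open>symR\<close>.\<close>
  have orig: "(Inl (Orig u), Inl (Orig v)) \<in> ?R" if "u \<in> ?V" "v \<in> ?V" for u v
  proof -
    have "(u, v) \<in> rtrancl_on ?V ((parcs G)\<^sup>s)"
      using assms(2) that by (simp add: connected_conv)
    then show ?thesis
    proof (induction rule: rtrancl_on_induct)
      case base
      then show ?case by (intro rtrancl_on_refl) (simp add: verts del: induce_subgraph_verts)
    next
      case (step y z)
      then have "{y, z} \<in> edges G"
        by (auto simp: symcl_def edges_def)
      then have "(Inl (Orig y), Inr (Orig ` {y, z})) \<in> ?R" "(Inl (Orig z), Inr (Orig ` {y, z})) \<in> ?R"
        by (intro incidence; use step in simp)+
      then show ?case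
        using step.IH symR by (meson rtrancl_on_trans symD)
    qed
  qed
  have to_orig: "\<exists>u\<in>?V. (Inl (Orig u), x) \<in> ?R" if x: "x \<in> verts ?K" for x
    using x[unfolded verts]
  proof (elim UnE imageE)
    fix v assume "x = Inl (Orig v)" "v \<in> ?V"
    then show ?thesis using orig by blast
  next
    fix e assume e: "x = Inr (Orig ` e)" "e \<in> edges G"
    obtain u where "u \<in> e" "u \<in> ?V"
      using e(2) by (elim edgesE) auto
    then show ?thesis using incidence e by blast
  qed
  have "(x, y) \<in> ?R" if "x \<in> verts ?K" "y \<in> verts ?K" for x y
    using to_orig[OF that(1)] to_orig[OF that(2)] orig symR by (meson rtrancl_on_trans symD)
  moreover have "verts ?K \<noteq> {}"
    unfolding verts using assms(2) by (simp add: connected_conv)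
  ultimately have "Digraph_Component.connected ?K"
    unfolding connected_conv by blast
  then show ?thesis
    using tds card by (auto simp: total_outer_connected_dominating_set_def)
qed

theorem theorem4p3:
  fixes G :: "'a pair_pre_digraph" and n :: nat
  assumes "pair_graph G"
    and "Digraph_Component.connected (with_proj G)"
    and "card (pverts G) = n"
    and "n \<ge> 2"
  shows "2 * n + total_domination_number (middle_graph G)
           \<le> total_outer_connected_domination_number (middle_graph (corona_P2 G))
       \<and> total_outer_connected_domination_number (middle_graph (corona_P2 G)) \<le> 4 * n"
proof -
  let ?P = "\<lambda>k. \<exists>D. total_outer_connected_dominating_set (middle_graph (corona_P2 G)) D \<and> card D = k"
  \<comment> \<open>This witness gives the upper bound and also ensures that the minimum is
    attained, so the lower bound can be applied to a minimum set.\<close>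
  have upper: "?P (4 * n)"
    using total_outer_connected_middle_corona_upper[OF assms(1,2)] assms(3) by simp
  then have "?P (Least ?P)"
    by (rule LeastI)
  then obtain D where D: "total_outer_connected_dominating_set (middle_graph (corona_P2 G)) D"
    "card D = total_outer_connected_domination_number (middle_graph (corona_P2 G))"
    unfolding total_outer_connected_domination_number_def by blast
  have "2 * n + total_domination_number (middle_graph G) \<le> card D"
    using total_outer_connected_middle_corona_lower[OF assms(1,2) _ D(1)] assms(3,4) by simp
  moreover have "total_outer_connected_domination_number (middle_graph (corona_P2 G)) \<le> 4 * n"
    unfolding total_outer_connected_domination_number_def using upper by (rule Least_le)
  ultimately show ?thesis
    using D(2) by simp
qed

end
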